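(* Let $G\subset O(n)$ be a closed subgroup which is not transitive on $S_{n-1}$ and suppose that $\operatorname{rank} G=n$. Then $G$ is reducible or finite.
   Context: $\mathbb{R}^n$ carries the canonical inner product and norm $\|\cdot\|$; $S_{n-1}$ is the unit sphere. $G$ is transitive if some orbit of a unit vector equals $S_{n-1}$; $G$ is reducible if it leaves invariant some linear subspace other than $\{0\}$ and $\mathbb{R}^n$. For a closed non-transitive subgroup $G$ and $v\in S_{n-1}$ put $h_v(w):=\inf_{g\in G}\|w-g(v)\|$. A maximin point of the orbit $P_G(v)=\{g(v) : g\in G\}$ is a unit vector $w$ at which $h_v$ attains its maximum over $S_{n-1}$. For such $w$ let $M(v,w):=\{g(v) : g\in G,\ \|w-g(v)\|=h_v(w)\}$. The linear subspace spanned by $M(v,w)\cup\{w\}$ is called a flat subspace of $G$ belonging to the orbit of $v$. The rank of $G$, denoted $\operatorname{rank}G$, is the maximal dimension of its flat subspaces (over all $v\in S_{n-1}$ and maximin points $w$ of $P_G(v)$). *)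

theory Defs
  imports "HOL-Analysis.Analysis" "HOL-Algebra.Group"
begin

definition orthogonal_group :: "(real^'n^'n) monoid" where
  "orthogonal_group = \<lparr>carrier = {A. orthogonal_matrix A}, mult = (**), one = mat 1\<rparr>"

lemma group_orthogonal_group: "group (orthogonal_group :: (real^'n^'n) monoid)"
proof (rule groupI)
  fix A :: "real^'n^'n"
  assume "A \<in> carrier orthogonal_group"
  then show "\<exists>B\<in>carrier orthogonal_group. B \<otimes>\<^bsub>orthogonal_group\<^esub> A = \<one>\<^bsub>orthogonal_group\<^esub>"
    by (intro bexI[of _ "transpose A"])
      (auto simp: orthogonal_group_def orthogonal_matrix_def)
qed (auto simp: orthogonal_group_def orthogonal_matrix_mul orthogonal_matrix_id matrix_mul_assoc)

definition orbit :: "(real^'n^'n) set \<Rightarrow> real^'n \<Rightarrow> (real^'n) set" where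
  "orbit G v = {g *v v | g. g \<in> G}"

definition transitive_on_sphere :: "(real^'n^'n) set \<Rightarrow> bool" where
  "transitive_on_sphere G \<longleftrightarrow> (\<exists>v. norm v = 1 \<and> orbit G v = sphere 0 1)"

definition reducible :: "(real^'n^'n) set \<Rightarrow> bool" where
  "reducible G \<longleftrightarrow>
    (\<exists>V. subspace V \<and> V \<noteq> {0} \<and> V \<noteq> UNIV \<and> (\<forall>g\<in>G. \<forall>x\<in>V. g *v x \<in> V))"

definition orbit_dist :: "(real^'n^'n) set \<Rightarrow> real^'n \<Rightarrow> real^'n \<Rightarrow> real" where
  "orbit_dist G v w = (INF g\<in>G. norm (w - g *v v))"

definition maximin_point :: "(real^'n^'n) set \<Rightarrow> real^'n \<Rightarrow> real^'n \<Rightarrow> bool" where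
  "maximin_point G v w \<longleftrightarrow>
    w \<in> sphere 0 1 \<and> (\<forall>u\<in>sphere 0 1. orbit_dist G v u \<le> orbit_dist G v w)"

definition nearest_points :: "(real^'n^'n) set \<Rightarrow> real^'n \<Rightarrow> real^'n \<Rightarrow> (real^'n) set" where
  "nearest_points G v w = {g *v v | g. g \<in> G \<and> norm (w - g *v v) = orbit_dist G v w}"

definition flat_subspace :: "(real^'n^'n) set \<Rightarrow> (real^'n) set \<Rightarrow> bool" where
  "flat_subspace G F \<longleftrightarrow>
    (\<exists>v w. v \<in> sphere 0 1 \<and> maximin_point G v w \<and> F = span (nearest_points G v w \<union> {w}))"

text \<open>Dimensions are bounded by \<open>CARD('n)\<close>, and for nonempty \<open>G\<close> maximin points exist by
  compactness of the sphere, so the maximum below is over a finite nonempty set.\<close>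

definition group_rank :: "(real^'n^'n) set \<Rightarrow> nat" where
  "group_rank G = Max {dim F | F. flat_subspace G F}"

end

theory Submission
  imports Defs
begin

text \<open>If \<open>m\<close> is a nearest point of an orbit to \<open>w\<close>, then moving \<open>m\<close> infinitesimally within its
  orbit does not change its inner product with \<open>w\<close>; so for every tangent direction \<open>X\<close> of \<open>G\<close> at
  the identity, \<open>X w\<close> is orthogonal to the flat subspace spanned by \<open>w\<close> and its nearest points. A
  flat subspace of full dimension therefore forces \<open>X w = 0\<close> for all \<open>X\<close>. The common kernel of all
  tangent directions is \<open>G\<close>-invariant since the set of directions is closed under conjugation, it
  contains \<open>w\<close>, and it is not the whole space if some direction is nonzero. By compactness this
  happens as soon as \<open>G\<close> is infinite. It suffices to work with the tangent cone; that it is the Lie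
  algebra of \<open>G\<close> plays no role.\<close>

text \<open>The Bouligand tangent cone of \<open>G\<close> at the identity, in sequential form. With
  limits of rescaled differences in place of derivatives of curves, compactness alone produces
  elements.\<close>

definition tangent_cone :: "(real^'n^'n) set \<Rightarrow> (real^'n^'n) set" where
  "tangent_cone G = {X. \<exists>g t. (\<forall>k. g k \<in> G) \<and> g \<longlonglongrightarrow> mat 1 \<and> (\<forall>k::nat. t k > (0::real)) \<and>
     (\<lambda>k. t k *\<^sub>R (g k - mat 1)) \<longlonglongrightarrow> X}"

section \<open>Orthogonal matrices and limits of matrix products\<close>

lemma subgroup_orthogonal_groupD:
  assumes "subgroup G orthogonal_group"
  shows "g \<in> G \<Longrightarrow> orthogonal_matrix g"
    and "mat 1 \<in> G"
    and "g \<in> G \<Longrightarrow> h \<in> G \<Longrightarrow> g ** h \<in> G"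
    and "g \<in> G \<Longrightarrow> transpose g \<in> G"
proof -
  show orth: "orthogonal_matrix g" if "g \<in> G" for g
    using subgroup.mem_carrier[OF assms that] by (simp add: orthogonal_group_def)
  show "mat 1 \<in> G"
    using subgroup.one_closed[OF assms] by (simp add: orthogonal_group_def)
  show "g \<in> G \<Longrightarrow> h \<in> G \<Longrightarrow> g ** h \<in> G"
    using subgroup.m_closed[OF assms, of g h] by (simp add: orthogonal_group_def)
  assume g: "g \<in> G"
  have "inv\<^bsub>orthogonal_group\<^esub> g = transpose g"
    using orth[OF g]
    by (intro group.inv_equality[OF group_orthogonal_group])
      (auto simp: orthogonal_group_def orthogonal_matrix_def)
  then show "transpose g \<in> G"
    using subgroup.m_inv_closed[OF assms g] by simp
qed

lemma orthogonal_matrix_inner: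
  fixes g :: "real^'n^'n"
  assumes "orthogonal_matrix g"
  shows "(g *v x) \<bullet> (g *v y) = x \<bullet> y"
  using assms
  by (metis dot_lmul_matrix matrix_vector_mul_assoc matrix_vector_mul_lid orthogonal_matrix
      transpose_matrix_vector)

lemma orthogonal_matrix_norm:
  fixes g :: "real^'n^'n"
  assumes "orthogonal_matrix g"
  shows "norm (g *v x) = norm x"
  using orthogonal_matrix_inner[OF assms] by (simp add: norm_eq_sqrt_inner)

lemma bounded_orthogonal_matrices: "bounded {A :: real^'n^'n. orthogonal_matrix A}"
proof (rule boundedI)
  fix A :: "real^'n^'n"
  assume "A \<in> {A. orthogonal_matrix A}"
  then have "norm (A $ i) = 1" for i
    by (metis mem_Collect_eq orthogonal_matrix_orthonormal_rows row_def vec_nth_inverse)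
  \<comment> \<open>The norm of \<open>A\<close> is the Euclidean norm of its row norms, hence at
    most their sum.\<close>
  then show "norm A \<le> real CARD('n)"
    using L2_set_le_sum[of UNIV "\<lambda>i. norm (A $ i)"] by (simp add: norm_vec_def)
qed

lemma tendsto_matrix_vector_mult:
  fixes A :: "'a \<Rightarrow> real^'n^'m"
  assumes "(A \<longlongrightarrow> X) F"
  shows "((\<lambda>k. A k *v x) \<longlongrightarrow> X *v x) F"
  unfolding matrix_vector_mult_def by (intro vec_tendstoI) (simp, intro tendsto_intros assms)

lemma tendsto_matrix_matrix_mult:
  fixes A :: "'a \<Rightarrow> real^'n^'m" and B :: "'a \<Rightarrow> real^'p^'n"
  assumes "(A \<longlongrightarrow> X) F" "(B \<longlongrightarrow> Y) F"
  shows "((\<lambda>k. A k ** B k) \<longlongrightarrow> X ** Y) F"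
  unfolding matrix_matrix_mult_def by (intro vec_tendstoI) (simp, intro tendsto_intros assms)

section \<open>Tangent directions at the identity\<close>

text \<open>Conjugation by \<open>h\<close> is linear and fixes the identity, so it carries the
  rescaled differences of \<open>g\<close> to those of the conjugated sequence, with the same
  factors \<open>t\<close>.\<close>

lemma tangent_cone_conj:
  assumes G: "subgroup G orthogonal_group" and X: "X \<in> tangent_cone G" and h: "h \<in> G"
  shows "transpose h ** X ** h \<in> tangent_cone G"
proof -
  obtain g and t :: "nat \<Rightarrow> real" where g: "\<And>k. g k \<in> G" "g \<longlonglongrightarrow> mat 1"
    and t: "\<And>k. t k > 0" and lim: "(\<lambda>k. t k *\<^sub>R (g k - mat 1)) \<longlonglongrightarrow> X"
    using X by (auto simp: tangent_cone_def)
  have hh: "transpose h ** h = mat 1"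
    using subgroup_orthogonal_groupD(1)[OF G h] by (simp add: orthogonal_matrix_def)
  have "transpose h ** g k ** h \<in> G" for k
    by (intro subgroup_orthogonal_groupD[OF G] g(1) h)
  moreover have "(\<lambda>k. transpose h ** g k ** h) \<longlonglongrightarrow> mat 1"
    using tendsto_matrix_matrix_mult[OF tendsto_matrix_matrix_mult[OF tendsto_const g(2)] tendsto_const]
    by (metis hh matrix_mul_rid)
  moreover have "t k *\<^sub>R (transpose h ** g k ** h - mat 1)
      = transpose h ** (t k *\<^sub>R (g k - mat 1)) ** h" for k
  proof -
    have "transpose h *v (h *v x) = x" for x
      by (simp add: matrix_vector_mul_assoc hh)
    then show ?thesis
      by (simp add: matrix_eq scaleR_matrix_vector_assoc[symmetric] matrix_vector_mult_diff_rdistrib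
          matrix_vector_mult_scaleR matrix_vector_mult_diff_distrib
          flip: matrix_vector_mul_assoc del: transpose_matrix_vector)
  qed
  moreover have "(\<lambda>k. transpose h ** (t k *\<^sub>R (g k - mat 1)) ** h) \<longlonglongrightarrow> transpose h ** X ** h"
    by (intro tendsto_matrix_matrix_mult tendsto_const lim)
  ultimately show ?thesis
    unfolding tangent_cone_def mem_Collect_eq using t
    by (intro exI[of _ "\<lambda>k. transpose h ** g k ** h"] exI[of _ t]) simp
qed

text \<open>An infinite compact group has an accumulation point, which translation moves to the
  identity. Normalized differences lie on a compact sphere, so a subsequence converges, to a limit
  of norm 1.\<close>

lemma nonzero_tangent_direction:
  fixes G :: "(real^'n^'n) set"
  assumes G: "subgroup G orthogonal_group" and "closed G" "infinite G"
  obtains X where "X \<in> tangent_cone G" "X \<noteq> 0"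
proof -
  note sub = subgroup_orthogonal_groupD[OF G]
  have "compact G"
    using sub(1) \<open>closed G\<close> bounded_subset[OF bounded_orthogonal_matrices]
    by (auto simp: compact_eq_bounded_closed)
  then obtain a where a: "a \<in> G" "a islimpt G"
    using Heine_Borel_imp_Bolzano_Weierstrass[of G G] \<open>infinite G\<close> by auto
  then obtain f :: "nat \<Rightarrow> _" where f: "\<And>k. f k \<in> G - {a}" "f \<longlonglongrightarrow> a"
    by (auto simp: islimpt_sequential)
  have aa: "transpose a ** a = mat 1" "a ** transpose a = mat 1"
    using sub(1)[OF a(1)] by (auto simp: orthogonal_matrix_def)
  define g where "g = (\<lambda>k. transpose a ** f k)"
  have gG: "g k \<in> G" for k
    using f(1) a(1) sub by (auto simp: g_def)
  have g1: "g k \<noteq> mat 1" for k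
  proof
    assume "g k = mat 1"
    then have "a ** (transpose a ** f k) = a"
      by (simp add: g_def)
    then show False
      using f(1)[of k] aa(2) by (simp add: matrix_mul_assoc)
  qed
  have glim: "g \<longlonglongrightarrow> mat 1"
    using tendsto_matrix_matrix_mult[OF tendsto_const f(2), of "transpose a"] by (simp add: g_def aa)
  define t where "t = (\<lambda>k. inverse (norm (g k - mat 1)))"
  have "t k *\<^sub>R (g k - mat 1) \<in> sphere 0 1" for k
    using g1 by (simp add: t_def)
  then obtain X r where X: "X \<in> sphere 0 1" "strict_mono r"
      and lim: "((\<lambda>k. t k *\<^sub>R (g k - mat 1)) \<circ> r) \<longlonglongrightarrow> X"
    using seq_compactE[of "sphere (0 :: real^'n^'n) 1" "\<lambda>k. t k *\<^sub>R (g k - mat 1)"]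
    by (auto simp flip: compact_eq_seq_compact_metric)
  have "X \<in> tangent_cone G"
    unfolding tangent_cone_def mem_Collect_eq
  proof (intro exI conjI allI)
    show "(g \<circ> r) k \<in> G" "(t \<circ> r) k > 0" for k
      using gG g1 by (simp_all add: t_def)
    show "(g \<circ> r) \<longlonglongrightarrow> mat 1"
      by (rule LIMSEQ_subseq_LIMSEQ[OF glim X(2)])
    show "(\<lambda>k. (t \<circ> r) k *\<^sub>R ((g \<circ> r) k - mat 1)) \<longlonglongrightarrow> X"
      using lim by (simp add: o_def)
  qed
  with X(1) show ?thesis
    by (intro that[of X]) auto
qed

text \<open>This is the first-order part of the invariance of the inner product under
  \<open>G\<close>.\<close>

lemma tangent_cone_inner_skew:
  assumes G: "subgroup G orthogonal_group" and X: "X \<in> tangent_cone G"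
  shows "(X *v x) \<bullet> y + x \<bullet> (X *v y) = 0"
proof -
  obtain g and t :: "nat \<Rightarrow> real" where g: "\<And>k. g k \<in> G" "g \<longlonglongrightarrow> mat 1"
    and lim: "(\<lambda>k. t k *\<^sub>R (g k - mat 1)) \<longlonglongrightarrow> X"
    using X by (auto simp: tangent_cone_def)
  define A where "A = (\<lambda>k. t k *\<^sub>R (g k - mat 1))"
  have A: "A k *v z = t k *\<^sub>R (g k *v z - z)" for k z
    by (simp add: A_def scaleR_matrix_vector_assoc[symmetric] matrix_vector_mult_diff_rdistrib)
  \<comment> \<open>Expansion of \<open>(g k *v x) \<bullet> (g k *v y) = x \<bullet> y\<close>
    around the identity, scaled by \<open>t k\<close>. The last summand vanishes in the limit since
    \<open>g k\<close> tends to the identity.\<close>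
  have *: "(A k *v x) \<bullet> y + x \<bullet> (A k *v y) + (A k *v x) \<bullet> (g k *v y - y) = 0" for k
    using orthogonal_matrix_inner[OF subgroup_orthogonal_groupD(1)[OF G g(1)], of k x y]
    by (simp add: A inner_diff_left inner_diff_right algebra_simps)
  have Alim: "(\<lambda>k. A k *v z) \<longlonglongrightarrow> X *v z" for z
    using tendsto_matrix_vector_mult[OF lim] by (simp add: A_def)
  have "(\<lambda>k. (A k *v x) \<bullet> y + x \<bullet> (A k *v y) + (A k *v x) \<bullet> (g k *v y - y))
      \<longlonglongrightarrow> (X *v x) \<bullet> y + x \<bullet> (X *v y) + (X *v x) \<bullet> (mat 1 *v y - y)"
    by (intro tendsto_intros Alim tendsto_matrix_vector_mult g)
  then show ?thesis
    unfolding * by (simp add: LIMSEQ_const_iff)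
qed

section \<open>First-order conditions at nearest points\<close>

text \<open>First-order condition for a maximum at the identity: the positive factors
  \<open>t k\<close> keep the sign of each difference.\<close>

lemma tangent_cone_inner_nonpos:
  assumes X: "X \<in> tangent_cone G" and le: "\<And>g. g \<in> G \<Longrightarrow> w \<bullet> (g *v m) \<le> w \<bullet> m"
  shows "w \<bullet> (X *v m) \<le> 0"
proof -
  obtain g and t :: "nat \<Rightarrow> real" where g: "\<And>k. g k \<in> G" and t: "\<And>k. t k > 0"
    and lim: "(\<lambda>k. t k *\<^sub>R (g k - mat 1)) \<longlonglongrightarrow> X"
    using X by (auto simp: tangent_cone_def)
  show ?thesis
  proof (rule LIMSEQ_le_const2)
    show "(\<lambda>k. w \<bullet> ((t k *\<^sub>R (g k - mat 1)) *v m)) \<longlonglongrightarrow> w \<bullet> (X *v m)"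
      by (intro tendsto_intros tendsto_matrix_vector_mult lim)
    have "w \<bullet> ((t k *\<^sub>R (g k - mat 1)) *v m) \<le> 0" for k
      using le[OF g[of k]] t[of k]
      by (simp add: scaleR_matrix_vector_assoc[symmetric] matrix_vector_mult_diff_rdistrib
          inner_diff_right mult_le_0_iff)
    then show "\<exists>N. \<forall>k\<ge>N. w \<bullet> ((t k *\<^sub>R (g k - mat 1)) *v m) \<le> 0"
      by blast
  qed
qed

text \<open>All points of an orbit have the same norm, so minimizing the distance to
  \<open>w\<close> means maximizing the inner product with \<open>w\<close>.\<close>

lemma nearest_points_inner_le:
  assumes G: "subgroup G orthogonal_group" and m: "m \<in> nearest_points G v w" and g: "g \<in> G"
  shows "w \<bullet> (g *v m) \<le> w \<bullet> m"
proof -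
  note sub = subgroup_orthogonal_groupD[OF G]
  obtain h where h: "h \<in> G" "m = h *v v" and d: "norm (w - m) = orbit_dist G v w"
    using m by (auto simp: nearest_points_def)
  have "bdd_below ((\<lambda>g. norm (w - g *v v)) ` G)"
    by (rule bdd_belowI2[of _ 0]) simp
  then have "orbit_dist G v w \<le> norm (w - (g ** h) *v v)"
    unfolding orbit_dist_def using sub(3)[OF g h(1)] by (rule cINF_lower)
  then have "norm (w - m) \<le> norm (w - g *v m)"
    using d by (simp add: h(2) matrix_vector_mul_assoc)
  then have "(w - m) \<bullet> (w - m) \<le> (w - g *v m) \<bullet> (w - g *v m)"
    by (simp add: norm_le)
  then show ?thesis
    using orthogonal_matrix_inner[OF sub(1)[OF g], of m m]
    by (simp add: inner_diff_left inner_diff_right inner_commute)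
qed

text \<open>For a nearest point \<open>m\<close>, both \<open>w \<bullet> (X *v m)\<close> and
  \<open>m \<bullet> (X *v w)\<close> are nonpositive, and by skewness they sum to zero, so both
  vanish.\<close>

lemma tangent_cone_annihilates:
  assumes G: "subgroup G orthogonal_group" and X: "X \<in> tangent_cone G"
    and span: "span (nearest_points G v w \<union> {w}) = UNIV"
  shows "X *v w = 0"
proof -
  have orth: "(X *v w) \<bullet> m = 0" if "m \<in> nearest_points G v w" for m
  proof -
    note le = nearest_points_inner_le[OF G that]
    have "(X *v w) \<bullet> m \<le> 0"
    proof -
      \<comment> \<open>Moving \<open>g\<close> to the other factor turns it into its transpose,
        which lies in \<open>G\<close>; thus \<open>m\<close> and \<open>w\<close> exchange
        roles.\<close>
      have "m \<bullet> (g *v w) \<le> m \<bullet> w" if "g \<in> G" for g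
        using le[OF subgroup_orthogonal_groupD(4)[OF G that]]
        by (metis dot_lmul_matrix inner_commute transpose_matrix_vector)
      then show ?thesis
        using tangent_cone_inner_nonpos[OF X] by (metis inner_commute)
    qed
    then show ?thesis
      using tangent_cone_inner_nonpos[OF X le] tangent_cone_inner_skew[OF G X, of w m] by linarith
  qed
  have "(X *v w) \<bullet> w = 0"
    using tangent_cone_inner_skew[OF G X, of w w] by (simp add: inner_commute)
  then have "orthogonal (X *v w) y" if "y \<in> nearest_points G v w \<union> {w}" for y
    using orth that by (auto simp: orthogonal_def)
  \<comment> \<open>The span is the whole space and so contains \<open>X *v w\<close>
    itself.\<close>
  then have "orthogonal (X *v w) (X *v w)"
    using orthogonal_to_span[of "X *v w" "nearest_points G v w \<union> {w}"] span by (metis UNIV_I)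
  then show ?thesis
    by (simp add: orthogonal_def)
qed

section \<open>Attainment of the rank\<close>

lemma maximin_point_exists:
  fixes G :: "(real^'n^'n) set"
  assumes "G \<noteq> {}"
  shows "\<exists>w. maximin_point G v w"
proof -
  \<comment> \<open>Distance to a set is continuous, so a maximum over the compact sphere
    exists.\<close>
  have "orbit_dist G v w = infdist w (orbit G v)" for w
    using assms
    by (simp add: orbit_dist_def infdist_def orbit_def dist_norm Setcompr_eq_image image_image)
  then have "continuous_on (sphere 0 1) (orbit_dist G v)"
    using continuous_on_infdist[OF continuous_on_id] by (simp cong: continuous_on_cong)
  moreover obtain e :: "real^'n" where "norm e = 1"
    using vector_choose_size[of 1] by auto
  ultimately show ?thesis
    using continuous_attains_sup[of "sphere 0 1" "orbit_dist G v"]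
    by (force simp: maximin_point_def)
qed

text \<open>\<open>Max\<close> returns a member only of a finite nonempty set; the dimension bound
  and the existence of maximin points supply this.\<close>

lemma flat_subspace_attaining_rank:
  fixes G :: "(real^'n^'n) set"
  assumes "G \<noteq> {}"
  obtains F where "flat_subspace G F" "dim F = group_rank G"
proof -
  let ?D = "{dim F | F. flat_subspace G F}"
  have "?D \<subseteq> {..CARD('n)}"
    by (auto intro: dim_subset_UNIV_cart)
  then have fin: "finite ?D"
    using finite_subset by blast
  obtain v :: "real^'n" where "norm v = 1"
    using vector_choose_size[of 1] by auto
  then have "?D \<noteq> {}"
    using maximin_point_exists[OF assms, of v] by (fastforce simp: flat_subspace_def)
  then have "group_rank G \<in> ?D"
    unfolding group_rank_def using fin by (rule Max_in[rotated])
  then show ?thesis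
    using that by auto
qed

theorem theorem4:
  fixes G :: "(real^'n^'n) set"
  assumes "subgroup G orthogonal_group"
    and "closed G"
    and "\<not> transitive_on_sphere G"
    and "group_rank G = CARD('n)"
  shows "reducible G \<or> finite G"
proof (rule disjCI)
  assume inf: "infinite G"
  note sub = subgroup_orthogonal_groupD[OF assms(1)]
  obtain F where "flat_subspace G F" "dim F = CARD('n)"
    using flat_subspace_attaining_rank[of G] sub(2) assms(4) by auto
  then obtain v w where w: "norm w = 1" and span: "span (nearest_points G v w \<union> {w}) = UNIV"
    unfolding flat_subspace_def maximin_point_def
    by (metis DIM_cart DIM_real dim_eq_full mem_sphere_0 mult.right_neutral span_span)
  \<comment> \<open>The common kernel is the invariant subspace: it contains \<open>w\<close>, and a
    nonzero direction makes it proper.\<close>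
  let ?V = "{u. \<forall>X\<in>tangent_cone G. X *v u = 0}"
  obtain X where X: "X \<in> tangent_cone G" "X \<noteq> 0"
    using nonzero_tangent_direction[OF assms(1,2) inf] .
  show "reducible G"
    unfolding reducible_def
  proof (intro exI conjI ballI)
    show "subspace ?V"
      by (auto simp: subspace_def matrix_vector_right_distrib matrix_vector_mult_scaleR)
    have "w \<in> ?V"
      using tangent_cone_annihilates[OF assms(1) _ span] by auto
    moreover have "w \<noteq> 0"
      using w by auto
    ultimately show "?V \<noteq> {0}"
      by blast
    show "?V \<noteq> UNIV"
    proof
      assume "?V = UNIV"
      then have "X *v u = 0 *v u" for u
        using X(1) by auto
      then show False
        using X(2) matrix_eq by blast
    qed
  next
    fix g u
    assume g: "g \<in> G" and u: "u \<in> ?V"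
    have "Y *v (g *v u) = 0" if "Y \<in> tangent_cone G" for Y
    proof -
      \<comment> \<open>The conjugate of \<open>Y\<close> by \<open>g\<close> is again a tangent
        direction, so it kills \<open>u\<close>; \<open>transpose g\<close> preserves norms and can
        then be cancelled.\<close>
      have "transpose g *v (Y *v (g *v u)) = 0"
        using u tangent_cone_conj[OF assms(1) that g]
        by (auto simp: matrix_vector_mul_assoc matrix_mul_assoc)
      then show ?thesis
        using orthogonal_matrix_norm[OF sub(1)[OF sub(4)[OF g]], of "Y *v (g *v u)"] by simp
    qed
    then show "g *v u \<in> ?V"
      by simp
  qed
qed

end
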